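(* For every integer $n>2$ there is no injective group homomorphism from $T_2$ to $T_n$.
   Context: For an integer $n\ge 2$, an $n$-adic subdivision of $[0,1]$ is a subdivision of $[0,1]$ into finitely many subintervals of the form $[\ell/n^k,(\ell+1)/n^k]$ with $k,\ell\ge 0$ integers and $\ell+1\le n^k$. Let $S^1=[0,1]/(0\sim 1)$; an $n$-adic subdivision of $S^1$ is one induced by an $n$-adic subdivision of $[0,1]$. $T_n$ is the group of orientation-preserving piecewise-linear homeomorphisms of $S^1$ which map the intervals of some $n$-adic subdivision of $S^1$ onto the intervals of another one (with the same number of intervals), affinely on each interval. $T_2=T$ is Thompson's group $T$. *)

theory Defs
  imports "HOL-Analysis.Analysis" "HOL-Algebra.Bij"
begin

text \<open>
  The circle \<open>[0,1]/(0 \<sim> 1)\<close> is realised as the unit circle of the complex plane, with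
  quotient map \<open>t \<mapsto> exp (2 \<pi> i t)\<close>; the two lemmas below state that this map is a
  topological quotient map on \<open>[0,1]\<close> identifying exactly \<open>0\<close> and \<open>1\<close>.
\<close>

abbreviation S1 :: "complex set" where
  "S1 \<equiv> sphere 0 1"

definition circ :: "real \<Rightarrow> complex" where
  "circ t = cis (2 * pi * t)"

lemma circ_eq_iff_unit:
  assumes "s \<in> {0..1}" "t \<in> {0..1}"
  shows "circ s = circ t \<longleftrightarrow> s = t \<or> {s, t} = {0, 1}"
proof
  assume "circ s = circ t"
  then have "exp (\<i> * complex_of_real (2 * pi * s)) = exp (\<i> * complex_of_real (2 * pi * t))"
    by (simp add: circ_def cis_conv_exp)
  then obtain m :: int where
    "\<i> * complex_of_real (2 * pi * s) = \<i> * complex_of_real (2 * pi * t) + of_int (2 * m) * (of_real pi * \<i>)"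
    unfolding exp_eq by auto
  then have "Im (\<i> * complex_of_real (2 * pi * s))
      = Im (\<i> * complex_of_real (2 * pi * t) + of_int (2 * m) * (of_real pi * \<i>))"
    by (rule arg_cong)
  then have "pi * s = pi * (t + of_int m)"
    by (simp add: algebra_simps)
  then have m: "s = t + of_int m"
    by (simp only: mult_cancel_left) simp
  with assms have "(of_int m :: real) \<le> 1" "(-1 :: real) \<le> of_int m"
    by auto
  then have "m = -1 \<or> m = 0 \<or> m = 1"
    by linarith
  with m assms show "s = t \<or> {s, t} = {0, 1}"
    by auto
next
  assume "s = t \<or> {s, t} = {0, 1}"
  then show "circ s = circ t"
    by (auto simp: circ_def doubleton_eq_iff)
qed

lemma circ_quotient_map:
  "quotient_map (top_of_set {0..1}) (top_of_set S1) circ"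
proof (rule T1_Spaces.continuous_imp_quotient_map)
  have "continuous_on {0..1} circ"
    unfolding circ_def cis_conv_exp by (intro continuous_intros)
  moreover have "circ ` {0..1} \<subseteq> S1"
    by (auto simp: circ_def)
  ultimately show "continuous_map (top_of_set {0..1}) (top_of_set S1) circ"
    by (auto simp: continuous_map_in_subtopology)
  show "compact_space (top_of_set {0..1::real})"
    by (simp add: compact_space_subtopology)
  show "Hausdorff_space (top_of_set S1)"
    by (simp add: Hausdorff_space_subtopology)
  have "z \<in> circ ` {0..1}" if "z \<in> S1" for z
  proof -
    have "exp (\<i> * of_real (Arg2pi z)) = z"
      using that complex_norm_eq_1_exp by simp
    then have "circ (Arg2pi z / (2 * pi)) = z"
      by (simp add: circ_def cis_conv_exp)
    moreover have "Arg2pi z / (2 * pi) \<in> {0..1}"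
      using Arg2pi_ge_0[of z] Arg2pi_lt_2pi[of z] by (simp add: divide_simps)
    ultimately show ?thesis
      by (metis image_eqI)
  qed
  then show "circ ` topspace (top_of_set {0..1}) = topspace (top_of_set S1)"
    by (auto simp: circ_def)
qed

definition nadic_subdivision :: "nat \<Rightarrow> real set set \<Rightarrow> bool" where
  "nadic_subdivision n D \<longleftrightarrow>
     D division_of {0..1} \<and>
     (\<forall>K\<in>D. \<exists>k l :: nat. l + 1 \<le> n ^ k \<and>
        K = {real l / real n ^ k .. real (l + 1) / real n ^ k})"

text \<open>
  A self-map of the circle is orientation preserving if it has a continuous strictly increasing
  lift to the universal cover \<open>circ : \<real> \<rightarrow> S1\<close> of degree one.
\<close>

definition orientation_preserving :: "(complex \<Rightarrow> complex) \<Rightarrow> bool" where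
  "orientation_preserving f \<longleftrightarrow>
     (\<exists>F :: real \<Rightarrow> real. continuous_on UNIV F \<and> strict_mono F \<and>
        (\<forall>x. F (x + 1) = F x + 1) \<and> (\<forall>x. f (circ x) = circ (F x)))"

text \<open>
  The bijection \<open>\<sigma>\<close> matches the intervals of \<open>D\<close> with those of \<open>E\<close>; affinity on an interval
  is meant in the coordinate \<open>t\<close> of \<open>[0,1]\<close>. Piecewise linearity of \<open>f\<close> is part of this
  condition, as \<open>D\<close> is finite.
\<close>

definition nadic_affine :: "nat \<Rightarrow> (complex \<Rightarrow> complex) \<Rightarrow> bool" where
  "nadic_affine n f \<longleftrightarrow>
     (\<exists>D E \<sigma>. nadic_subdivision n D \<and> nadic_subdivision n E \<and> bij_betw \<sigma> D E \<and>
        (\<forall>K\<in>D. \<exists>a b :: real. (\<lambda>t. a * t + b) ` K = \<sigma> K \<and>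
            (\<forall>t\<in>K. f (circ t) = circ (a * t + b))))"

text \<open>
  Elements are extensional functions (equal to \<open>undefined\<close> off the circle), so that they are
  determined by their values on the circle; the group operation is the composition of \<open>BijGroup\<close>.
\<close>

definition thompson_T :: "nat \<Rightarrow> (complex \<Rightarrow> complex) monoid" where
  "thompson_T n = BijGroup S1
     \<lparr>carrier := {f \<in> Bij S1. (\<exists>g. homeomorphism S1 S1 f g) \<and>
        orientation_preserving f \<and> nadic_affine n f}\<rparr>"

end

theory Submission
  imports Defs "HOL-Number_Theory.Cong"
begin

text \<open>
  The obstruction is torsion. Let \<open>F\<close> be a lift to the line of an element of \<open>T\<^sub>n\<close>. Its slopes are
  powers of \<open>n\<close>, hence congruent to 1 modulo \<open>n - 1\<close>, so the displacement \<open>F x - x\<close> of an n-adic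
  rational \<open>x\<close> has the same residue \<open>c\<close> in \<open>\<int>[1/n] / (n - 1) \<cong> \<int> / (n - 1)\<close> for all \<open>x\<close>. If the
  element has order dividing \<open>n - 1\<close>, then \<open>F ^^ (n - 1)\<close> is the translation by an integer congruent
  to \<open>(n - 1) c = 0\<close>, say by \<open>(n - 1) r\<close>. So \<open>x \<mapsto> F x - r\<close> is an increasing map of finite order
  on the line, hence the identity, and the element is trivial. But \<open>T\<^sub>2\<close> contains an element of
  order \<open>n - 1\<close>, which cyclically permutes the \<open>n - 1\<close> intervals of a dyadic subdivision.
\<close>

section \<open>The circle\<close>

lemma circ_eq_iff: "circ s = circ t \<longleftrightarrow> s - t \<in> \<int>"
proof -
  have "circ s = circ t \<longleftrightarrow> (\<exists>m::int. 2 * pi * s = 2 * pi * t + 2 * pi * of_int m)"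
    unfolding circ_def complex_eq_iff by (metis cis.sel sin_cos_eq_iff add.commute)
  also have "\<dots> \<longleftrightarrow> (\<exists>m::int. s - t = of_int m)"
  proof -
    have "2 * pi * s = 2 * pi * t + 2 * pi * of_int m \<longleftrightarrow> s - t = of_int m" for m :: int
    proof -
      have "2 * pi * s = 2 * pi * t + 2 * pi * of_int m \<longleftrightarrow> (2 * pi) * s = (2 * pi) * (t + of_int m)"
        by (simp only: distrib_left)
      also have "\<dots> \<longleftrightarrow> s = t + of_int m"
        by (subst mult_cancel_left) simp
      finally show ?thesis by auto
    qed
    then show ?thesis by blast
  qed
  finally show ?thesis by (auto elim: Ints_cases)
qed

lemma norm_circ [simp]: "norm (circ t) = 1"
  by (simp add: circ_def)

lemma circ_in_S1: "circ t \<in> S1"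
  by simp

lemma circ_onto_S1:
  assumes "z \<in> S1" obtains t where "0 \<le> t" "t < 1" "z = circ t"
proof -
  have "\<exists>t\<in>{0..1}. z = circ t"
    using circ_quotient_map assms
    by (auto simp: quotient_map_def image_iff dest!: equalityD2)
  then obtain t where t: "0 \<le> t" "t \<le> 1" "z = circ t" by auto
  have "circ 1 = circ 0" by (simp add: circ_eq_iff)
  with t that[of t] that[of 0] show thesis by (cases "t = 1") auto
qed

lemma funpow_lift:
  assumes "\<And>x. f (circ x) = circ (F x)"
  shows "(f ^^ k) (circ x) = circ ((F ^^ k) x)"
  using assms by (induction k) auto

text \<open>A strictly increasing map that moves \<open>x\<close> to one side pushes every further
  iterate to that same side, so the orbit of a non-fixed point never returns to
  \<open>x\<close>.\<close>

lemma funpow_fixed_point_imp_fixed_point: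
  fixes F :: "'a::linorder \<Rightarrow> 'a"
  assumes "strict_mono F" "(F ^^ k) x = x" "k > 0"
  shows "F x = x"
proof (rule ccontr)
  assume ne: "F x \<noteq> x"
  show False
  proof (cases "F x < x")
    case True
    have "(F ^^ Suc j) x < x" for j
      by (induction j) (use True strict_monoD[OF assms(1)] in \<open>auto intro: less_trans\<close>)
    from this[of "k - 1"] show False using assms by simp
  next
    case False
    then have lt: "x < F x" using ne by simp
    have "x < (F ^^ Suc j) x" for j
      by (induction j) (use lt strict_monoD[OF assms(1)] in \<open>auto intro: less_trans\<close>)
    from this[of "k - 1"] show False using assms by simp
  qed
qed

lemma degree_one_add_int:
  fixes F :: "real \<Rightarrow> real"
  assumes "\<And>x. F (x + 1) = F x + 1"
  shows "F (x + of_int m) = F x + of_int m"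
proof (induction m rule: int_induct[of _ 0])
  case (step1 i) then show ?case using assms[of "x + of_int i"] by (simp add: add.assoc)
next
  case (step2 i) then show ?case using assms[of "x + of_int (i - 1)"] by simp
qed simp

section \<open>Residues modulo n - 1 of n-adic rationals\<close>

text \<open>For positive \<open>n\<close> this is the ring \<int>[1/n], inside the reals.\<close>

definition adic :: "nat \<Rightarrow> real set" where
  "adic n = {of_int a / real n ^ k | a k. True}"

text \<open>The ideal of \<int>[1/n] generated by n - 1: two n-adic numbers are congruent modulo n -
  1 when their difference lies in it.\<close>

definition adic_ideal :: "nat \<Rightarrow> real set" where
  "adic_ideal n = {(real n - 1) * x | x. x \<in> adic n}"

lemma adicI: "of_int a / real n ^ k \<in> adic n"
  by (auto simp: adic_def)

lemma adic_of_int: "of_int m \<in> adic n"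
  using adicI[of m n 0] by simp

lemma adic_nat_divide: "real l / real n ^ k \<in> adic n"
  using adicI[of "int l" n k] by simp

lemma adic_add:
  assumes "n > 0" "x \<in> adic n" "y \<in> adic n" shows "x + y \<in> adic n"
proof -
  from assms obtain a k b j where "x = of_int a / real n ^ k" "y = of_int b / real n ^ j"
    by (auto simp: adic_def)
  with \<open>n > 0\<close> have "x + y = of_int (a * int n ^ j + b * int n ^ k) / real n ^ (k + j)"
    by (simp add: add_divide_distrib power_add)
  then show ?thesis using adicI by metis
qed

lemma adic_mult:
  assumes "x \<in> adic n" "y \<in> adic n" shows "x * y \<in> adic n"
proof -
  from assms obtain a k b j where "x = of_int a / real n ^ k" "y = of_int b / real n ^ j"
    by (auto simp: adic_def)
  then have "x * y = of_int (a * b) / real n ^ (k + j)"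
    by (simp add: power_add)
  then show ?thesis using adicI by metis
qed

lemma adic_diff:
  assumes "n > 0" "x \<in> adic n" "y \<in> adic n" shows "x - y \<in> adic n"
  using adic_add[OF assms(1,2) adic_mult[OF adic_of_int[of "-1"] assms(3)]] by simp

lemma adic_ideal_0 [simp]: "0 \<in> adic_ideal n"
  unfolding adic_ideal_def using adic_of_int[of 0 n] by (auto intro!: exI[of _ 0])

lemma adic_ideal_add:
  assumes "n > 0" "x \<in> adic_ideal n" "y \<in> adic_ideal n" shows "x + y \<in> adic_ideal n"
proof -
  from assms obtain u v where "x = (real n - 1) * u" "y = (real n - 1) * v" "u \<in> adic n" "v \<in> adic n"
    by (auto simp: adic_ideal_def)
  then have "x + y = (real n - 1) * (u + v)" "u + v \<in> adic n"
    using adic_add[OF assms(1)] by (simp_all add: distrib_left)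
  then show ?thesis unfolding adic_ideal_def by blast
qed

lemma adic_ideal_mult:
  assumes "x \<in> adic_ideal n" "y \<in> adic n" shows "x * y \<in> adic_ideal n"
proof -
  from assms obtain u where "x = (real n - 1) * u" "u \<in> adic n"
    by (auto simp: adic_ideal_def)
  then have "x * y = (real n - 1) * (u * y)" "u * y \<in> adic n"
    using adic_mult assms(2) by simp_all
  then show ?thesis unfolding adic_ideal_def by blast
qed

text \<open>As n is congruent to 1 modulo n - 1, so are all its powers. This is applied to the
  slopes of elements of \<open>T_n\<close>.\<close>

lemma power_ratio_minus_1_in_adic_ideal:
  assumes "n > 0"
  shows "real n ^ k / real n ^ j - 1 \<in> adic_ideal n"
proof -
  have "[int n ^ k = 1] (mod (int n - 1))" for k
  proof -
    have "[int n = 1] (mod (int n - 1))" by (simp add: cong_iff_dvd_diff)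
    from cong_pow[OF this, of k] show ?thesis by simp
  qed
  from this[of k] this[of j] have "[int n ^ k = int n ^ j] (mod (int n - 1))"
    by (meson cong_sym cong_trans)
  then obtain m where "int n ^ k - int n ^ j = (int n - 1) * m"
    by (auto simp: cong_iff_dvd_diff dvd_def)
  then have "real n ^ k - real n ^ j = (real n - 1) * of_int m"
    using arg_cong[of _ _ "of_int :: int \<Rightarrow> real"] by fastforce
  then have "real n ^ k / real n ^ j - 1 = (real n - 1) * (of_int m / real n ^ j)"
    using assms by (simp add: field_simps)
  then show ?thesis unfolding adic_ideal_def using adicI by blast
qed

text \<open>Clearing the denominator n^k loses nothing because n^k is coprime to n - 1. This brings
  a congruence in \<int>[1/n] back to the integers.\<close>

lemma of_int_in_adic_ideal_imp_dvd:
  assumes "n > 0" "of_int p \<in> adic_ideal n"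
  shows "(int n - 1) dvd p"
proof -
  from assms obtain m k where "of_int p = (real n - 1) * (of_int m / real n ^ k)"
    by (auto simp: adic_ideal_def adic_def)
  with \<open>n > 0\<close> have "of_int p * real n ^ k = (real n - 1) * of_int m"
    by (simp add: field_simps)
  then have "(of_int (p * int n ^ k) :: real) = of_int ((int n - 1) * m)"
    by simp
  then have "p * int n ^ k = (int n - 1) * m"
    by (simp only: of_int_eq_iff)
  then have "(int n - 1) dvd p * int n ^ k" by simp
  moreover have "coprime (int n - 1) (int n ^ k)"
    using coprime_diff_one_left[of "int n"] by simp
  ultimately show ?thesis by (simp add: coprime_dvd_mult_left_iff)
qed

lemma nadic_subdivision_interval:
  assumes "nadic_subdivision n D" "K \<in> D"
  obtains k l where "K = {real l / real n ^ k .. real (l + 1) / real n ^ k}"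
  using assms unfolding nadic_subdivision_def by blast

section \<open>Torsion in the group T(n)\<close>

text \<open>The difference of \<open>F\<close> and the affine map is continuous and integer valued,
  hence constant on the interval. As \<open>F\<close> increases, so does the affine map, and left
  endpoint goes to left endpoint.\<close>

lemma lift_affine_on_interval:
  fixes F :: "real \<Rightarrow> real"
  assumes contF: "continuous_on {x..y} F" and "strict_mono F" and "x < y"
    and lift: "\<And>t. t \<in> {x..y} \<Longrightarrow> circ (F t) = circ (a * t + b)"
    and img: "(\<lambda>t. a * t + b) ` {x..y} = {u..v}"
  obtains m :: int where "a = (v - u) / (y - x)"
    "\<And>t. t \<in> {x..y} \<Longrightarrow> F t = a * (t - x) + u + of_int m"
proof -
  let ?g = "\<lambda>t. F t - (a * t + b)"
  have ints: "?g t \<in> \<int>" if "t \<in> {x..y}" for t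
    using lift[OF that] by (simp add: circ_eq_iff)
  have "?g constant_on {x..y}"
  proof (rule continuous_discrete_range_constant)
    show "connected {x..y}" by simp
    show "continuous_on {x..y} ?g" by (intro continuous_intros contF)
    show "\<exists>e>0. \<forall>t'. t' \<in> {x..y} \<and> ?g t' \<noteq> ?g t \<longrightarrow> e \<le> norm (?g t' - ?g t)"
      if "t \<in> {x..y}" for t
    \<comment> \<open>Distinct integers are at distance at least 1.\<close>
    proof (intro exI[of _ 1] conjI allI impI)
      fix t' assume t': "t' \<in> {x..y} \<and> ?g t' \<noteq> ?g t"
      then have "?g t' - ?g t \<in> \<int>" using Ints_diff[OF ints[of t'] ints[OF that]] by blast
      with t' show "1 \<le> norm (?g t' - ?g t)"
        using Ints_nonzero_abs_ge1[of "?g t' - ?g t"] by simp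
    qed simp
  qed
  then obtain c where c: "\<And>t. t \<in> {x..y} \<Longrightarrow> ?g t = c" by (auto simp: constant_on_def)
  have "c \<in> \<int>" using ints[of x] c[of x] \<open>x < y\<close> by simp
  then obtain m :: int where m: "c = of_int m" by (auto elim: Ints_cases)
  have "F x < F y" using assms by (simp add: strict_mono_def)
  then have "a * x < a * y" using c[of x] c[of y] \<open>x < y\<close> by simp
  then have "a > 0" using \<open>x < y\<close> by (simp add: mult_less_cancel_left)
  have "(\<lambda>t. a * t + b) ` {x..y} = {a * x + b..a * y + b}"
    using \<open>a > 0\<close> \<open>x < y\<close> by (simp add: image_affinity_atLeastAtMost)
  with img \<open>a > 0\<close> \<open>x < y\<close> have uv: "u = a * x + b" "v = a * y + b"
    by (auto simp: Icc_eq_Icc)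
  show thesis
  proof (rule that)
    show "a = (v - u) / (y - x)" using \<open>x < y\<close> uv by (simp add: field_simps)
    show "F t = a * (t - x) + u + of_int m" if "t \<in> {x..y}" for t
      using c[OF that] m uv by (simp add: algebra_simps)
  qed
qed

text \<open>On one interval \<open>F\<close> has a slope \<open>a\<close>, so displacements differ
  by (a - 1)(y - x), where a - 1 lies in the ideal and y - x in the ring.\<close>

lemma nadic_affine_lift_step:
  fixes F :: "real \<Rightarrow> real"
  assumes "n > 0" and contF: "continuous_on UNIV F" and monoF: "strict_mono F"
    and lift: "\<And>x. f (circ x) = circ (F x)"
    and "nadic_subdivision n D" "nadic_subdivision n E" "bij_betw \<sigma> D E"
    and aff: "\<forall>K\<in>D. \<exists>a b :: real. (\<lambda>t. a * t + b) ` K = \<sigma> K \<and> (\<forall>t\<in>K. f (circ t) = circ (a * t + b))"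
    and K: "K \<in> D"
    and xy: "x \<in> K \<inter> adic n" "y \<in> K \<inter> adic n"
  shows "F x \<in> adic n" "(F y - y) - (F x - x) \<in> adic_ideal n"
proof -
  obtain k l :: nat where Kdef: "K = {real l / real n ^ k .. real (l + 1) / real n ^ k}"
    using nadic_subdivision_interval[OF \<open>nadic_subdivision n D\<close> K] by blast
  have "\<sigma> K \<in> E" using \<open>bij_betw \<sigma> D E\<close> K by (auto simp: bij_betw_def)
  then obtain k' l' :: nat where sK: "\<sigma> K = {real l' / real n ^ k' .. real (l' + 1) / real n ^ k'}"
    using nadic_subdivision_interval[OF \<open>nadic_subdivision n E\<close>] by blast
  obtain a b where ab: "(\<lambda>t. a * t + b) ` K = \<sigma> K" "\<forall>t\<in>K. f (circ t) = circ (a * t + b)"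
    using aff K by blast
  define w where "w = real l / real n ^ k"
  define w' where "w' = real l' / real n ^ k'"
  obtain m where am: "a = (real (l' + 1) / real n ^ k' - w') / (real (l + 1) / real n ^ k - w)"
    and m: "\<And>t. t \<in> K \<Longrightarrow> F t = a * (t - w) + w' + of_int m"
  proof (rule lift_affine_on_interval)
    show "continuous_on {w..real (l + 1) / real n ^ k} F"
      using contF continuous_on_subset by blast
    show "w < real (l + 1) / real n ^ k"
      using \<open>n > 0\<close> by (simp add: w_def divide_strict_right_mono)
    show "(\<lambda>t. a * t + b) ` {w..real (l + 1) / real n ^ k} = {w'..real (l' + 1) / real n ^ k'}"
      using ab(1) sK by (simp add: Kdef w_def w'_def)
    show "circ (F t) = circ (a * t + b)" if "t \<in> {w..real (l + 1) / real n ^ k}" for t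
      using ab(2) that lift by (simp add: Kdef w_def)
  qed (use monoF that in \<open>auto simp: Kdef w_def\<close>)
  \<comment> \<open>The slope is the ratio of the lengths n^(-k') and n^(-k) of the two
    intervals.\<close>
  have a: "a = real n ^ k / real n ^ k'"
    using am \<open>n > 0\<close> by (simp add: w_def w'_def diff_divide_distrib[symmetric])
  have a_adic: "a \<in> adic n"
    using adic_nat_divide[of "n ^ k" n k'] by (simp add: a)
  have "x - w \<in> adic n"
    using adic_diff[OF \<open>n > 0\<close>] adic_nat_divide xy by (auto simp: w_def)
  then show "F x \<in> adic n"
    using m[of x] xy adic_add[OF \<open>n > 0\<close>] adic_mult[OF a_adic] adic_of_int adic_nat_divide
    by (auto simp: w'_def)
  have "(F y - y) - (F x - x) = (a - 1) * (y - x)"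
    using m[of x] m[of y] xy by (simp add: algebra_simps)
  moreover have "a - 1 \<in> adic_ideal n"
    unfolding a by (rule power_ratio_minus_1_in_adic_ideal) fact
  ultimately show "(F y - y) - (F x - x) \<in> adic_ideal n"
    using adic_ideal_mult adic_diff[OF \<open>n > 0\<close>] xy by auto
qed

text \<open>
  Two n-adic points in a common interval of the subdivision have the same displacement modulo
  the ideal; as intersecting intervals meet in n-adic endpoints, connectedness of
  \<open>[0,1]\<close> propagates this to all n-adic points.
\<close>

lemma lift_displacement:
  fixes F :: "real \<Rightarrow> real"
  assumes n: "n > 0" and contF: "continuous_on UNIV F" and monoF: "strict_mono F"
    and deg: "\<And>x. F (x + 1) = F x + 1"
    and lift: "\<And>x. f (circ x) = circ (F x)"
    and "nadic_affine n f" and x: "x \<in> adic n"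
  shows "F x \<in> adic n" "(F x - x) - F 0 \<in> adic_ideal n"
proof -
  obtain D E \<sigma> where D: "nadic_subdivision n D" and rest: "nadic_subdivision n E" "bij_betw \<sigma> D E"
    "\<forall>K\<in>D. \<exists>a b :: real. (\<lambda>t. a * t + b) ` K = \<sigma> K \<and> (\<forall>t\<in>K. f (circ t) = circ (a * t + b))"
    using \<open>nadic_affine n f\<close> unfolding nadic_affine_def by blast
  note step = nadic_affine_lift_step[OF n contF monoF lift D rest]
  have div: "D division_of {0..1}" using D by (simp add: nadic_subdivision_def)
  have UD: "\<Union>D = {0..1}" and finD: "finite D" using div by auto
  have closedK: "closed K" if "K \<in> D" for K
    by (rule nadic_subdivision_interval[OF D that]) simp
  have left_end: "\<exists>w. w \<in> K \<inter> adic n" if K: "K \<in> D" for K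
  proof -
    obtain k l :: nat where "K = {real l / real n ^ k .. real (l + 1) / real n ^ k}"
      by (rule nadic_subdivision_interval[OF D K])
    then have "real l / real n ^ k \<in> K" using n by (simp add: divide_right_mono)
    then show ?thesis using adic_nat_divide by blast
  qed
  have meet: "t \<in> adic n" if "K \<in> D" "L \<in> D" "K \<noteq> L" "t \<in> K" "t \<in> L" for K L t
  proof (rule ccontr)
    assume t: "t \<notin> adic n"
    \<comment> \<open>A point that is not n-adic is no endpoint, so it would be interior to both
      intervals, whose interiors are disjoint.\<close>
    have "t \<in> interior J" if J: "J \<in> D" "t \<in> J" for J
    proof -
      obtain k l :: nat where Jd: "J = {real l / real n ^ k .. real (l + 1) / real n ^ k}"
        by (rule nadic_subdivision_interval[OF D J(1)])
      have "t \<noteq> real l / real n ^ k" "t \<noteq> real (l + 1) / real n ^ k"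
        using t adic_nat_divide by metis+
      with J(2) show ?thesis unfolding Jd by (simp only: interior_atLeastAtMost_real) auto
    qed
    then have "t \<in> interior K \<inter> interior L" using that by blast
    then show False using division_ofD(5)[OF div] that by auto
  qed
  define good where "good = {K \<in> D. \<forall>t \<in> K \<inter> adic n. (F t - t) - F 0 \<in> adic_ideal n}"
  \<comment> \<open>One n-adic point decides for the whole interval.\<close>
  have goodI: "K \<in> good" if "K \<in> D" "t \<in> K \<inter> adic n" "(F t - t) - F 0 \<in> adic_ideal n" for K t
    unfolding good_def
  proof (intro CollectI conjI ballI)
    fix s assume "s \<in> K \<inter> adic n"
    from adic_ideal_add[OF n step(2)[OF that(1,2) this] that(3)]
    show "(F s - s) - F 0 \<in> adic_ideal n" by (simp add: algebra_simps)
  qed fact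
  have "\<exists>K\<in>D. 0 \<in> K" using UD by (metis UnionE atLeastAtMost_iff order_refl zero_le_one)
  then obtain K0 where K0: "K0 \<in> D" "0 \<in> K0" by blast
  have "0 \<in> adic n" using adic_of_int[of 0] by simp
  with K0 have "K0 \<in> good" using goodI[of K0 0] by auto
  have disjoint: "\<Union>good \<inter> \<Union>(D - good) = {}"
  proof (rule ccontr)
    assume "\<Union>good \<inter> \<Union>(D - good) \<noteq> {}"
    then obtain K L t where KL: "K \<in> good" "L \<in> D" "L \<notin> good" "t \<in> K" "t \<in> L" by blast
    then have "K \<in> D" "K \<noteq> L" by (auto simp: good_def)
    then have "t \<in> adic n" using meet KL by blast
    with KL goodI[of L t] show False by (auto simp: good_def)
  qed
  have closed: "closed (\<Union>good)" "closed (\<Union>(D - good))"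
    using finD closedK by (auto simp: good_def intro!: closed_Union)
  have "good \<union> (D - good) = D" by (auto simp: good_def)
  then have cover: "\<Union>good \<union> \<Union>(D - good) = {0..1}" using UD by (metis Union_Un_distrib)
  have "\<Union>good \<inter> {0..1} = {} \<or> \<Union>(D - good) \<inter> {0..1} = {}"
    by (rule connected_closedD) (use disjoint closed cover in auto)
  moreover have "0 \<in> \<Union>good \<inter> {0..1}" using K0 \<open>K0 \<in> good\<close> by auto
  ultimately have empty: "\<Union>(D - good) = {}" using cover by blast
  have unit: "F t \<in> adic n \<and> (F t - t) - F 0 \<in> adic_ideal n" if t: "t \<in> {0..1}" "t \<in> adic n" for t
  proof -
    obtain K where K: "K \<in> D" "t \<in> K" using UD t by blast
    then have "K \<in> good" using empty by blast
    with K t step(1)[OF K(1), of t t] show ?thesis by (auto simp: good_def)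
  qed
  \<comment> \<open>By degree one, the displacement of \<open>F\<close> is 1-periodic, so the
    fractional part of \<open>x\<close> suffices.\<close>
  define t where "t = x - of_int \<lfloor>x\<rfloor>"
  have t: "t \<in> {0..1}" "t \<in> adic n"
    unfolding t_def using x adic_diff[OF n] adic_of_int by (auto; linarith)+
  have "x = t + of_int \<lfloor>x\<rfloor>" by (simp add: t_def)
  then have Fx: "F x = F t + of_int \<lfloor>x\<rfloor>"
    using degree_one_add_int[of F, OF deg, of t "\<lfloor>x\<rfloor>"] by simp
  show "F x \<in> adic n" using unit[OF t] Fx adic_add[OF n] adic_of_int by simp
  show "(F x - x) - F 0 \<in> adic_ideal n" using unit[OF t] Fx by (simp add: t_def algebra_simps)
qed

lemma thompson_torsion_free_at_n_minus_1:
  assumes n: "n > 1" and op: "orientation_preserving f" and "nadic_affine n f"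
    and per: "\<And>z. z \<in> S1 \<Longrightarrow> (f ^^ (n - 1)) z = z"
    and z: "z \<in> S1"
  shows "f z = z"
proof -
  obtain F :: "real \<Rightarrow> real" where contF: "continuous_on UNIV F" and monoF: "strict_mono F"
    and deg: "\<And>x. F (x + 1) = F x + 1" and lift: "\<And>x. f (circ x) = circ (F x)"
    using op by (auto simp: orientation_preserving_def)
  have n0: "n > 0" using n by simp
  note disp = lift_displacement[OF n0 contF monoF deg lift \<open>nadic_affine n f\<close>]
  have zero: "(0::real) \<in> adic n" using adic_of_int[of 0] by simp
  \<comment> \<open>The orbit of 0 stays n-adic, and each step contributes the residue of
    \<open>F 0\<close>.\<close>
  have iter: "(F ^^ i) 0 \<in> adic n \<and> (F ^^ i) 0 - real i * F 0 \<in> adic_ideal n" for i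
  proof (induction i)
    case (Suc i)
    then have "F ((F ^^ i) 0) - (F ^^ i) 0 - F 0 + ((F ^^ i) 0 - real i * F 0) \<in> adic_ideal n"
      using disp(2) adic_ideal_add[OF n0] by blast
    with Suc disp(1) show ?case by (simp add: algebra_simps)
  qed (simp add: zero)
  have int_disp: "(F ^^ (n - 1)) x - x \<in> \<int>" for x
  proof -
    have "circ ((F ^^ (n - 1)) x) = circ x"
      using per[OF circ_in_S1] funpow_lift[of f F "n - 1" x, OF lift] by simp
    then show ?thesis by (simp only: circ_eq_iff)
  qed
  obtain p :: int where p: "(F ^^ (n - 1)) 0 = of_int p"
    using int_disp[of 0] by (auto elim: Ints_cases)
  \<comment> \<open>\<open>F 0\<close> need not be an integer, but it is n-adic, so n - 1 times it
    lies in the ideal.\<close>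
  have "(real n - 1) * F 0 \<in> adic_ideal n"
    using disp(1)[OF zero] by (auto simp: adic_ideal_def)
  moreover have "of_int p - real (n - 1) * F 0 \<in> adic_ideal n"
    using iter[of "n - 1"] unfolding p by blast
  ultimately have "of_int p - real (n - 1) * F 0 + (real n - 1) * F 0 \<in> adic_ideal n"
    using adic_ideal_add[OF n0] by blast
  then have "of_int p \<in> adic_ideal n"
    using n by (simp add: of_nat_diff)
  then obtain r where r: "p = (int n - 1) * r"
    using of_int_in_adic_ideal_imp_dvd[OF n0] by auto
  \<comment> \<open>Another lift of \<open>f\<close>, chosen so that its iterate of order n - 1
    fixes 0.\<close>
  define G where "G = (\<lambda>x. F x - of_int r)"
  have monoG: "strict_mono G" using monoF by (simp add: G_def strict_mono_def)
  have GF: "(G ^^ i) x = (F ^^ i) x - of_int (int i * r)" for i x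
  proof (induction i)
    case (Suc i)
    have "(G ^^ Suc i) x = F ((F ^^ i) x + of_int (- (int i * r))) - of_int r"
      using Suc by (simp add: G_def)
    also have "\<dots> = (F ^^ Suc i) x - of_int (int (Suc i) * r)"
      unfolding degree_one_add_int[of F, OF deg] by (simp add: algebra_simps)
    finally show ?case .
  qed simp
  define H where "H = G ^^ (n - 1)"
  have "strict_mono (G ^^ i)" for i
    by (induction i) (use monoG in \<open>auto simp: strict_mono_def\<close>)
  then have monoH: "strict_mono H" by (simp add: H_def)
  have H0: "H 0 = 0" using n unfolding H_def GF p by (simp add: r of_nat_diff)
  have degG: "G (x + 1) = G x + 1" for x by (simp add: G_def deg)
  have "(G ^^ i) (x + 1) = (G ^^ i) x + 1" for i x by (induction i) (simp_all add: degG)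
  then have H1: "H 1 = 1" using H0 by (metis H_def add_0)
  obtain x where x: "0 \<le> x" "x < 1" "z = circ x" using circ_onto_S1[OF z] by blast
  \<comment> \<open>\<open>H\<close> is increasing and fixes 0 and 1, so it maps [0,1) to itself;
    there an integer displacement can only be 0.\<close>
  have "0 \<le> H x" "H x < 1"
    using strict_mono_less_eq[OF monoH, of 0 x] strict_mono_less[OF monoH, of x 1] x H0 H1 by auto
  moreover have "H x - x \<in> \<int>"
    using Ints_diff[OF int_disp[of x], of "of_int (int (n - 1) * r)"]
    by (simp add: H_def GF algebra_simps)
  ultimately have "H x = x"
    using x Ints_nonzero_abs_ge1[of "H x - x"] by fastforce
  then have "G x = x"
    using funpow_fixed_point_imp_fixed_point[OF monoG, of "n - 1" x] n by (simp add: H_def)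
  then have "F x - x \<in> \<int>" by (simp add: G_def algebra_simps)
  then show ?thesis by (simp add: x lift circ_eq_iff)
qed


section \<open>Circle maps from lifts\<close>

text \<open>The choice of the preimage \<open>t\<close> is harmless for maps of degree one. The
  restriction to \<open>S1\<close> makes the map extensional, as \<open>Bij\<close> demands.\<close>

definition circle_map :: "(real \<Rightarrow> real) \<Rightarrow> complex \<Rightarrow> complex" where
  "circle_map F = (\<lambda>z\<in>S1. circ (F (SOME t. z = circ t)))"

text \<open>The chosen preimage differs from \<open>x\<close> by an integer, and \<open>F\<close>
  commutes with integer translations.\<close>

lemma circle_map_circ:
  assumes deg: "\<And>x. F (x + 1) = F x + 1"
  shows "circle_map F (circ x) = circ (F x)"
proof -
  define t where "t = (SOME t. circ x = circ t)"
  have "circ x = circ t" unfolding t_def by (rule someI[of _ x]) simp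
  then obtain m :: int where m: "x = t + of_int m"
    by (auto simp: circ_eq_iff elim!: Ints_cases) (metis add.commute diff_add_cancel)
  have "circle_map F (circ x) = circ (F t)"
    using circ_in_S1[of x] by (simp add: circle_map_def t_def)
  then show ?thesis
    using degree_one_add_int[of F, OF deg, of t m] by (simp add: m circ_eq_iff)
qed

lemma circle_map_undefined: "z \<notin> S1 \<Longrightarrow> circle_map F z = undefined"
  by (simp add: circle_map_def)

lemma circle_map_comp:
  assumes "\<And>x. F (x + 1) = F x + 1" "\<And>x. G (x + 1) = G x + 1"
  shows "compose S1 (circle_map G) (circle_map F) = circle_map (G \<circ> F)"
proof
  fix z
  show "compose S1 (circle_map G) (circle_map F) z = circle_map (G \<circ> F) z"
  proof (cases "z \<in> S1")
    case True
    then obtain t where "z = circ t" by (rule circ_onto_S1)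
    with True assms show ?thesis by (simp add: compose_def circle_map_circ)
  qed (simp add: compose_def circle_map_undefined)
qed

lemma circle_map_add_int: "circle_map (\<lambda>x. x + of_int m) = (\<lambda>z\<in>S1. z)"
proof
  fix z show "circle_map (\<lambda>x. x + of_int m) z = (\<lambda>z\<in>S1. z) z"
  proof (cases "z \<in> S1")
    case True
    then obtain t where "z = circ t" by (rule circ_onto_S1)
    moreover have "circle_map (\<lambda>x. x + of_int m) (circ t) = circ (t + of_int m)"
      by (rule circle_map_circ) simp
    ultimately show ?thesis using True by (simp add: circ_eq_iff)
  qed (simp add: circle_map_undefined)
qed

text \<open>A monotone function can be discontinuous only by jumping, and a jump would leave a gap
  in its range.\<close>

lemma strict_mono_surj_continuous:
  fixes F :: "real \<Rightarrow> real"
  assumes "strict_mono F" "surj F"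
  shows "continuous_on UNIV F"
  by (rule continuous_onI_mono) (use assms in \<open>auto simp: strict_mono_less_eq\<close>)

text \<open>Since \<open>circ\<close> is a quotient map on [0,1], continuity need only be checked
  after composing with it.\<close>

lemma continuous_on_circle_map:
  assumes "\<And>x. F (x + 1) = F x + 1" "continuous_on UNIV F"
  shows "continuous_on S1 (circle_map F)"
proof -
  have "continuous_on {0..1} (\<lambda>t. circ (F t))"
    unfolding circ_def cis_conv_exp
    by (intro continuous_intros continuous_on_subset[OF assms(2)]) auto
  then have "continuous_map (top_of_set {0..1}) euclidean (circle_map F \<circ> circ)"
    by (simp add: o_def circle_map_circ assms(1))
  then have "continuous_map (top_of_set S1) euclidean (circle_map F)"
    by (rule continuous_compose_quotient_map[OF circ_quotient_map])
  then show ?thesis by simp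
qed

lemma bij_betw_circle_map:
  assumes deg: "\<And>x. F (x + 1) = F x + 1" and "strict_mono F" "surj F"
  shows "bij_betw (circle_map F) S1 S1"
  unfolding bij_betw_def
proof
  note circ = circle_map_circ[of F, OF deg]
  show "inj_on (circle_map F) S1"
  proof (rule inj_onI)
    fix z w assume zw: "z \<in> S1" "w \<in> S1" "circle_map F z = circle_map F w"
    obtain s where s: "z = circ s" using circ_onto_S1[OF zw(1)] by blast
    obtain t where t: "w = circ t" using circ_onto_S1[OF zw(2)] by blast
    have "F s - F t \<in> \<int>" using zw(3) by (simp add: s t circ circ_eq_iff)
    then obtain m :: int where "F s - F t = of_int m" by (rule Ints_cases)
    then have "F s = F (t + of_int m)" using degree_one_add_int[of F, OF deg, of t m] by simp
    then have "s = t + of_int m" using \<open>strict_mono F\<close> by (simp add: strict_mono_eq)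
    then show "z = w" by (simp add: s t circ_eq_iff)
  qed
  show "circle_map F ` S1 = S1"
  proof
    show "circle_map F ` S1 \<subseteq> S1"
    proof
      fix w assume "w \<in> circle_map F ` S1"
      then obtain z where z: "z \<in> S1" "w = circle_map F z" by blast
      obtain s where "z = circ s" using circ_onto_S1[OF z(1)] by blast
      then show "w \<in> S1" using z(2) circ by simp
    qed
    show "S1 \<subseteq> circle_map F ` S1"
    proof
      fix w assume "w \<in> S1"
      then obtain t where t: "w = circ t" by (rule circ_onto_S1)
      obtain s where "t = F s" using \<open>surj F\<close> by (rule surjE)
      then have "w = circle_map F (circ s)" using t circ by simp
      then show "w \<in> circle_map F ` S1" using circ_in_S1 by blast
    qed
  qed
qed

section \<open>Circle maps permuting the intervals of one subdivision affinely\<close>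

definition affine_permutation :: "real set set \<Rightarrow> (complex \<Rightarrow> complex) \<Rightarrow> bool" where
  "affine_permutation D f \<longleftrightarrow> (\<exists>\<sigma>. bij_betw \<sigma> D D \<and>
     (\<forall>K\<in>D. \<exists>a b :: real. (\<lambda>t. a * t + b) ` K = \<sigma> K \<and>
        (\<forall>t\<in>K. f (circ t) = circ (a * t + b))))"

lemma affine_permutation_nadic:
  assumes "nadic_subdivision n D" "affine_permutation D f"
  shows "nadic_affine n f"
proof -
  obtain \<sigma> where "bij_betw \<sigma> D D"
    "\<forall>K\<in>D. \<exists>a b :: real. (\<lambda>t. a * t + b) ` K = \<sigma> K \<and> (\<forall>t\<in>K. f (circ t) = circ (a * t + b))"
    using assms(2) unfolding affine_permutation_def by (elim exE conjE)
  with assms(1) show ?thesis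
    unfolding nadic_affine_def by (intro exI[of _ D] exI[of _ \<sigma>] conjI)
qed

lemma affine_permutation_id: "affine_permutation D (\<lambda>z. z)"
  unfolding affine_permutation_def
proof (intro exI[of _ "\<lambda>K. K"] conjI ballI)
  show "bij_betw (\<lambda>K. K) D D" by (simp add: bij_betw_def)
  show "\<exists>a b :: real. (\<lambda>t. a * t + b) ` K = K \<and> (\<forall>t\<in>K. circ t = circ (a * t + b))" for K
    by (rule exI[of _ 1], rule exI[of _ 0]) simp
qed

text \<open>With the same subdivision as source and target, \<open>f\<close> carries
  \<open>K\<close> onto an interval on which \<open>g\<close> is affine; the subdivision need not be
  refined.\<close>

lemma affine_permutation_comp:
  assumes "affine_permutation D f" "affine_permutation D g"
  shows "affine_permutation D (\<lambda>z. g (f z))"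
proof -
  obtain \<sigma> where s: "bij_betw \<sigma> D D"
    "\<forall>K\<in>D. \<exists>a b :: real. (\<lambda>t. a * t + b) ` K = \<sigma> K \<and> (\<forall>t\<in>K. f (circ t) = circ (a * t + b))"
    using assms(1) unfolding affine_permutation_def by (elim exE conjE)
  obtain \<tau> where t: "bij_betw \<tau> D D"
    "\<forall>K\<in>D. \<exists>a b :: real. (\<lambda>t. a * t + b) ` K = \<tau> K \<and> (\<forall>t\<in>K. g (circ t) = circ (a * t + b))"
    using assms(2) unfolding affine_permutation_def by (elim exE conjE)
  have "\<exists>a b :: real. (\<lambda>t. a * t + b) ` K = \<tau> (\<sigma> K) \<and> (\<forall>t\<in>K. g (f (circ t)) = circ (a * t + b))"
    if K: "K \<in> D" for K
  proof -
    obtain a b where ab: "(\<lambda>t. a * t + b) ` K = \<sigma> K" "\<forall>t\<in>K. f (circ t) = circ (a * t + b)"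
      using bspec[OF s(2) K] by (elim exE conjE)
    have "\<sigma> K \<in> D" using s(1) K by (auto simp: bij_betw_def)
    from bspec[OF t(2) this] obtain c d where cd: "(\<lambda>t. c * t + d) ` \<sigma> K = \<tau> (\<sigma> K)"
      "\<forall>t\<in>\<sigma> K. g (circ t) = circ (c * t + d)"
      by (elim exE conjE)
    have comp: "c * (a * x + b) + d = (c * a) * x + (c * b + d)" for x
      by (simp add: algebra_simps)
    have "(\<lambda>t. (c * a) * t + (c * b + d)) ` K = (\<lambda>t. c * t + d) ` (\<lambda>t. a * t + b) ` K"
      by (simp add: image_image comp)
    moreover have "\<forall>t\<in>K. g (f (circ t)) = circ ((c * a) * t + (c * b + d))"
    proof
      fix t assume "t \<in> K"
      then have "a * t + b \<in> \<sigma> K" "f (circ t) = circ (a * t + b)" using ab by auto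
      with cd(2) comp show "g (f (circ t)) = circ ((c * a) * t + (c * b + d))" by metis
    qed
    ultimately show ?thesis
      by (intro exI[of _ "c * a"] exI[of _ "c * b + d"]) (simp only: ab(1) cd(1) simp_thms)
  qed
  moreover have "bij_betw (\<lambda>K. \<tau> (\<sigma> K)) D D"
    using bij_betw_trans[OF s(1) t(1)] by (simp add: o_def)
  ultimately show ?thesis
    unfolding affine_permutation_def by (intro exI[of _ "\<lambda>K. \<tau> (\<sigma> K)"] conjI ballI)
qed

lemma affine_permutation_funpow:
  assumes "affine_permutation D f"
  shows "affine_permutation D (f ^^ i)"
proof (induction i)
  case 0
  then show ?case using affine_permutation_id by (simp add: id_def)
next
  case (Suc i)
  then show ?case using affine_permutation_comp[OF Suc assms] by (simp add: o_def)
qed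

lemma circle_map_in_thompson_T:
  assumes deg: "\<And>x. F (x + 1) = F x + 1" and mono: "strict_mono F" and surj: "surj F"
    and aff: "nadic_affine n (circle_map F)"
  shows "circle_map F \<in> carrier (thompson_T n)"
proof -
  note cont = strict_mono_surj_continuous[OF mono surj]
  note bij = bij_betw_circle_map[of F, OF deg mono surj]
  have "circle_map F \<in> Bij S1"
    using bij by (auto simp: Bij_def circle_map_def)
  \<comment> \<open>A continuous bijection of the compact circle has a continuous inverse.\<close>
  moreover have "\<exists>g. homeomorphism S1 S1 (circle_map F) g"
    using bij continuous_on_circle_map[of F, OF deg cont]
    by (intro homeomorphism_compact) (auto simp: bij_betw_def)
  moreover have "orientation_preserving (circle_map F)"
    unfolding orientation_preserving_def using cont mono deg circle_map_circ[of F, OF deg] by blast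
  ultimately show ?thesis using aff by (simp add: thompson_T_def)
qed

section \<open>A torsion element of T of every order\<close>

text \<open>The points 0, 1/2, 3/4, ..., 1 - 1/2^(p+1), 1. The p + 2 intervals between them are the
  leaves of a binary tree in comb shape; the last two have equal length.\<close>

definition dyadic_point :: "nat \<Rightarrow> nat \<Rightarrow> real" where
  "dyadic_point p i = (if i \<le> Suc p then 1 - 1 / 2 ^ i else 1)"

definition dyadic_comb :: "nat \<Rightarrow> real set set" where
  "dyadic_comb p = (\<lambda>i. {dyadic_point p i .. dyadic_point p (Suc i)}) ` {..<Suc (Suc p)}"

text \<open>
  The lift on \<open>[0,1]\<close> of the map taking the \<open>i\<close>-th of the \<open>p + 2\<close> intervals to the next one.
  Its slopes 1/2, 1, \<open>2 ^ p\<close> increase, so it is the maximum of its affine pieces.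
\<close>

definition comb_shift :: "nat \<Rightarrow> real \<Rightarrow> real" where
  "comb_shift p x = max (max ((x + 1) / 2) (x + 1 / 2 ^ Suc p)) (2 ^ p * (x - 1) + 3 / 2)"

text \<open>The pieces fit together at the integers because \<open>comb_shift\<close> takes the
  values 1/2 at 0 and 3/2 at 1.\<close>

definition comb_lift :: "nat \<Rightarrow> real \<Rightarrow> real" where
  "comb_lift p x = of_int \<lfloor>x\<rfloor> + comb_shift p (x - of_int \<lfloor>x\<rfloor>)"

text \<open>Replaces the powers of 2 by reals with \<open>E * e = 1\<close>, so that comparing the
  affine pieces becomes elementary algebra.\<close>

lemma comb_shift_parameters:
  obtains e E :: real where "0 < e" "1 \<le> E" "E * e = 1"
    "1 / 2 ^ p = e" "1 / 2 ^ Suc p = e / 2" "2 ^ p = E"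
    "\<And>x. comb_shift p x = max (max ((x + 1) / 2) (x + e / 2)) (E * (x - 1) + 3 / 2)"
  by (rule that[of "1 / 2 ^ p" "2 ^ p"]) (simp_all add: comb_shift_def)

lemma comb_shift_left:
  assumes "x \<le> 1 - 1 / 2 ^ p" shows "comb_shift p x = (x + 1) / 2"
proof -
  obtain e E :: real where eE: "0 < e" "1 \<le> E" "E * e = 1" "1 / 2 ^ p = e"
    and shift: "\<And>x. comb_shift p x = max (max ((x + 1) / 2) (x + e / 2)) (E * (x - 1) + 3 / 2)"
    by (rule comb_shift_parameters[of p], rule that)
  have x: "x \<le> 1 - e" using assms eE by simp
  \<comment> \<open>The comparison with the right piece needs the average of the two lower bounds 1
    and 1 - x for E (1 - x).\<close>
  have "1 \<le> E * (1 - x)" using mult_left_mono[of e "1 - x" E] x eE by simp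
  moreover have "1 - x \<le> E * (1 - x)" using mult_right_mono[of 1 E "1 - x"] x eE by simp
  moreover have "E * (x - 1) = - (E * (1 - x))" by (simp add: algebra_simps)
  ultimately have "E * (x - 1) + 3 / 2 \<le> (x + 1) / 2" by argo
  with x show ?thesis by (simp add: shift max_def)
qed

lemma comb_shift_middle:
  assumes "1 - 1 / 2 ^ p \<le> x" "x \<le> 1 - 1 / 2 ^ Suc p" shows "comb_shift p x = x + 1 / 2 ^ Suc p"
proof -
  obtain e E :: real where eE: "0 < e" "1 \<le> E" "E * e = 1" "1 / 2 ^ p = e" "1 / 2 ^ Suc p = e / 2"
    and shift: "\<And>x. comb_shift p x = max (max ((x + 1) / 2) (x + e / 2)) (E * (x - 1) + 3 / 2)"
    by (rule comb_shift_parameters[of p], rule that)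
  have x: "1 - e \<le> x" "x \<le> 1 - e / 2" using assms unfolding eE by auto
  \<comment> \<open>Since \<open>E * e = 1\<close>, twice the middle piece minus twice the right
    piece is (E - 1)(2(1 - x) - e).\<close>
  have "(E - 1) * e \<le> (E - 1) * (2 * (1 - x))" using x eE by (intro mult_left_mono) auto
  then have right: "E * (x - 1) + 3 / 2 \<le> x + e / 2" using eE(3) by (simp add: algebra_simps)
  have left: "(x + 1) / 2 \<le> x + e / 2" using x by simp
  show ?thesis unfolding shift eE(5) max_absorb2[OF left] using right by (rule max_absorb1)
qed

lemma comb_shift_right:
  assumes "1 - 1 / 2 ^ Suc p \<le> x" shows "comb_shift p x = 2 ^ p * (x - 1) + 3 / 2"
proof -
  obtain e E :: real where eE: "0 < e" "1 \<le> E" "E * e = 1" "1 / 2 ^ Suc p = e / 2" "2 ^ p = E"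
    and shift: "\<And>x. comb_shift p x = max (max ((x + 1) / 2) (x + e / 2)) (E * (x - 1) + 3 / 2)"
    by (rule comb_shift_parameters[of p], rule that)
  have x: "1 - e / 2 \<le> x" using assms unfolding eE by auto
  \<comment> \<open>The same factorisation, now beyond the breakpoint 1 - e/2.\<close>
  have "(E - 1) * (2 * (1 - x)) \<le> (E - 1) * e" using x eE by (intro mult_left_mono) auto
  then have right: "x + e / 2 \<le> E * (x - 1) + 3 / 2" using eE(3) by (simp add: algebra_simps)
  have left: "(x + 1) / 2 \<le> x + e / 2" using x eE(1) by simp
  show ?thesis unfolding shift eE(5) max_absorb2[OF left] using right by (rule max_absorb2)
qed

lemma comb_shift_0: "comb_shift p 0 = 1 / 2"
  using comb_shift_left[of 0 p] by (simp add: divide_simps)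

lemma comb_shift_1: "comb_shift p 1 = 3 / 2"
  using comb_shift_right[of p 1] by simp

lemma strict_mono_comb_shift: "strict_mono (comb_shift p)"
proof (rule strict_monoI)
  fix x y :: real assume "x < y"
  then have "2 ^ p * (x - 1) < 2 ^ p * (y - 1)" by simp
  moreover have max: "max a b < max c d" if "a < c" "b < d" for a b c d :: real
    using that by (auto simp: less_max_iff_disj)
  ultimately show "comb_shift p x < comb_shift p y"
    unfolding comb_shift_def by (intro max) (use \<open>x < y\<close> in auto)
qed

section \<open>The lift of degree one and its period\<close>

lemma comb_lift_unit:
  assumes "0 \<le> x" "x \<le> 1" shows "comb_lift p x = comb_shift p x"
proof (cases "x = 1")
  case True
  then show ?thesis by (simp add: comb_lift_def comb_shift_0 comb_shift_1)
next
  case False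
  with assms have "\<lfloor>x\<rfloor> = 0" by (simp add: floor_eq_iff)
  then show ?thesis by (simp add: comb_lift_def)
qed

lemma comb_lift_degree_one: "comb_lift p (x + 1) = comb_lift p x + 1"
  by (simp add: comb_lift_def)

lemma strict_mono_comb_lift: "strict_mono (comb_lift p)"
proof (rule strict_monoI)
  fix x y :: real assume "x < y"
  note mono = strict_mono_less[OF strict_mono_comb_shift[of p]]
    strict_mono_less_eq[OF strict_mono_comb_shift[of p]]
  show "comb_lift p x < comb_lift p y"
  proof (cases "\<lfloor>x\<rfloor> = \<lfloor>y\<rfloor>")
    case True
    then show ?thesis using \<open>x < y\<close> by (simp add: comb_lift_def mono)
  next
    case False
    then have "\<lfloor>x\<rfloor> < \<lfloor>y\<rfloor>" using \<open>x < y\<close> floor_mono[of x y] by linarith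
    \<comment> \<open>Over one unit the shift stays below 3/2, and the next unit starts at 1 +
      1/2.\<close>
    then have "of_int \<lfloor>x\<rfloor> + 1 \<le> (of_int \<lfloor>y\<rfloor> :: real)" by linarith
    moreover have "comb_shift p (x - of_int \<lfloor>x\<rfloor>) < comb_shift p 1"
      unfolding mono by linarith
    moreover have "comb_shift p 0 \<le> comb_shift p (y - of_int \<lfloor>y\<rfloor>)"
      unfolding mono by simp
    ultimately show ?thesis by (simp add: comb_lift_def comb_shift_0 comb_shift_1)
  qed
qed

lemma funpow_comb_lift_degree_one: "(comb_lift p ^^ i) (x + 1) = (comb_lift p ^^ i) x + 1"
  by (induction i) (simp_all add: comb_lift_degree_one)

lemma strict_mono_funpow_comb_lift: "strict_mono (comb_lift p ^^ i)"
  by (induction i) (use strict_mono_comb_lift in \<open>auto simp: strict_mono_def\<close>)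

text \<open>The map commutes with its iterates and with translation by 1, so periodicity passes from
  a point to its image.\<close>

lemma comb_lift_period_step:
  assumes "(comb_lift p ^^ q) x = x + 1"
  shows "(comb_lift p ^^ q) (comb_lift p x) = comb_lift p x + 1"
  using assms by (simp add: funpow_swap1[symmetric] comb_lift_degree_one)

text \<open>In terms of the distance \<open>u\<close> to 1, the left piece halves it. After p
  halvings one middle step leads into the last interval, and one right step gives the remaining
  factor 2^p.\<close>

lemma comb_lift_period_first_interval:
  assumes u: "1 / 2 \<le> u" "u \<le> 1"
  shows "(comb_lift p ^^ Suc (Suc p)) (1 - u) = 2 - u"
proof -
  have iter: "i \<le> p \<Longrightarrow> (comb_lift p ^^ i) (1 - u) = 1 - u / 2 ^ i" for i
  proof (induction i)
    case (Suc i)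
    \<comment> \<open>As \<open>u\<close> is at least 1/2, the point is still within the left piece
      before each of the first p steps.\<close>
    have "1 / 2 ^ p \<le> 1 / (2::real) ^ Suc i"
      using Suc.prems by (intro divide_left_mono power_increasing) auto
    also have "\<dots> \<le> u / 2 ^ i" using u by (simp add: field_simps)
    finally have le: "1 - u / 2 ^ i \<le> 1 - 1 / 2 ^ p" by simp
    have "u / 2 ^ i \<le> 1" "0 \<le> u / 2 ^ i" using u order_trans[of u 1 "2 ^ i"] by simp_all
    then have "comb_lift p (1 - u / 2 ^ i) = (1 - u / 2 ^ i + 1) / 2"
      using le by (simp add: comb_lift_unit comb_shift_left)
    also have "\<dots> = 1 - u / 2 ^ Suc i" by (simp add: field_simps)
    finally show ?case using Suc by simp
  qed simp
  define e :: real where "e = 1 / 2 ^ p"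
  have e: "0 < e" "e \<le> 1" "2 ^ p * e = 1" "1 / 2 ^ Suc p = e / 2" by (simp_all add: e_def)
  have ue: "e / 2 \<le> u * e" "u * e \<le> e"
    using u e(1,2) mult_right_mono[of "1 / 2" u e] mult_right_mono[of u 1 e] by simp_all
  have unit: "0 \<le> 1 - u * e" "1 - u * e \<le> 1" "0 \<le> 1 - u * e + e / 2" "1 - u * e + e / 2 \<le> 1"
    using ue e(1,2) by linarith+
  have "(comb_lift p ^^ p) (1 - u) = 1 - u * e" using iter[of p] by (simp add: e_def)
  moreover have "comb_lift p (1 - u * e) = 1 - u * e + e / 2"
    unfolding comb_lift_unit[OF unit(1,2)] e(4)[symmetric]
    by (rule comb_shift_middle) (use ue e(4) in \<open>auto simp: e_def\<close>)
  moreover have "comb_lift p (1 - u * e + e / 2) = 2 ^ p * (e / 2 - u * e) + 3 / 2"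
    unfolding comb_lift_unit[OF unit(3,4)]
    by (subst comb_shift_right) (use ue e(4) in \<open>auto simp: algebra_simps\<close>)
  moreover have "2 ^ p * (e / 2 - u * e) = (1 / 2 - u) * (2 ^ p * e)" by (simp add: algebra_simps)
  ultimately show ?thesis using e(3) by simp
qed

text \<open>Every later interval is the image of its predecessor, so periodicity spreads from the
  first interval over [0,1], and by degree one over the line.\<close>

lemma comb_lift_period: "(comb_lift p ^^ Suc (Suc p)) x = x + 1"
proof -
  let ?periodic = "\<lambda>x. (comb_lift p ^^ Suc (Suc p)) x = x + 1"
  have left: "i \<le> p \<Longrightarrow> 1 / 2 ^ Suc i \<le> u \<Longrightarrow> u \<le> 1 \<Longrightarrow> ?periodic (1 - u)" for i u
  proof (induction i arbitrary: u)
    case 0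
    then show ?case using comb_lift_period_first_interval[of u p] by simp
  next
    case (Suc i)
    show ?case
    proof (cases "1 / 2 ^ Suc i \<le> u")
      case True
      then show ?thesis using Suc by simp
    next
      case False
      \<comment> \<open>Here 1 - u is the image of 1 - 2u under the left piece.\<close>
      define d where "d = 1 / (2::real) ^ Suc i"
      have "d \<le> 1 / 2" by (simp add: d_def field_simps)
      moreover have "u < d" "d / 2 \<le> u" using False Suc.prems by (simp_all add: d_def)
      ultimately have "d \<le> 2 * u" "2 * u \<le> 1" by linarith+
      then have u: "1 / 2 ^ Suc i \<le> 2 * u" "2 * u \<le> 1" by (simp_all add: d_def)
      have "?periodic (1 - 2 * u)" using Suc.IH[of "2 * u"] Suc.prems u by simp
      moreover have "1 / 2 ^ p \<le> 1 / (2::real) ^ Suc i"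
        using Suc.prems by (intro divide_left_mono power_increasing) auto
      then have "comb_lift p (1 - 2 * u) = 1 - u"
        using u order_trans[of 0 "1 / 2 ^ Suc i" "2 * u"]
          comb_shift_left[of "1 - 2 * u" p] comb_lift_unit[of "1 - 2 * u" p]
        by simp
      ultimately show ?thesis using comb_lift_period_step[of _ p "1 - 2 * u"] by metis
    qed
  qed
  have unit: "?periodic (1 - u)" if u: "0 \<le> u" "u \<le> 1" for u
  proof (cases "1 / 2 ^ Suc p \<le> u")
    case True
    then show ?thesis using left[of p] u by blast
  next
    case False
    \<comment> \<open>In the last interval, 1 - u is the image of 1 - v under the middle
      piece.\<close>
    define v where "v = u + 1 / 2 ^ Suc p"
    define e where "e = 1 / (2::real) ^ Suc p"
    have "0 < e" "2 * e \<le> 1" "u < e" using False by (simp_all add: e_def)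
    moreover have "v = u + e" by (simp add: v_def e_def)
    ultimately have "e \<le> v" "v \<le> 2 * e" "v \<le> 1" "0 \<le> v" using u by linarith+
    then have v: "1 / 2 ^ Suc p \<le> v" "v \<le> 1 / 2 ^ p" "v \<le> 1" "0 \<le> v"
      by (simp_all add: e_def)
    have "?periodic (1 - v)" using left[of p] v by blast
    moreover have "comb_lift p (1 - v) = 1 - u"
      using v comb_shift_middle[of p "1 - v"] comb_lift_unit[of "1 - v" p] by (simp add: v_def)
    ultimately show ?thesis using comb_lift_period_step[of _ p "1 - v"] by metis
  qed
  have "0 \<le> 1 - frac x" "1 - frac x \<le> 1" using frac_lt_1[of x] by simp_all
  from unit[OF this] have "?periodic (frac x)" by simp
  then have "?periodic (frac x + of_int \<lfloor>x\<rfloor>)"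
    unfolding degree_one_add_int[of "comb_lift p ^^ Suc (Suc p)", OF funpow_comb_lift_degree_one]
    by simp
  then show ?thesis by (simp only: frac_def diff_add_cancel)
qed

text \<open>As p + 2 steps amount to translation by 1, p + 1 steps from y - 1 reach a preimage of
  \<open>y\<close>.\<close>

lemma surj_comb_lift: "surj (comb_lift p)"
proof (rule surjI)
  fix y
  have "(comb_lift p ^^ Suc (Suc p)) (y - 1) = y" using comb_lift_period[of p "y - 1"] by simp
  then show "comb_lift p ((comb_lift p ^^ Suc p) (y - 1)) = y" by simp
qed

lemma surj_funpow_comb_lift: "surj (comb_lift p ^^ i)"
proof (induction i)
  case (Suc i)
  then show ?case using comp_surj[OF Suc surj_comb_lift, of p] by (simp add: o_def)
qed simp

section \<open>The dyadic subdivision and membership in \<open>T_2\<close>\<close>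

lemma increasing_points_division:
  fixes d :: "nat \<Rightarrow> real"
  assumes "\<And>i. i \<le> N \<Longrightarrow> d i < d (Suc i)"
  shows "(\<lambda>i. {d i .. d (Suc i)}) ` {..<Suc N} division_of {d 0 .. d (Suc N)} \<and> d 0 < d (Suc N)"
  using assms
proof (induction N)
  case 0
  have "{d 0..d 1} \<noteq> {}" using 0[of 0] by simp
  then have "{{d 0..d 1}} division_of {d 0..d 1}"
    using division_of_self[of "d 0" "d 1"] by simp
  then show ?case using 0 by (simp add: lessThan_Suc)
next
  case (Suc N)
  have lt: "d (Suc N) < d (Suc (Suc N))" using Suc.prems by simp
  \<comment> \<open>The inequality is carried through the induction so that the old interval and the
    new one join to a single interval.\<close>
  have IH: "(\<lambda>i. {d i .. d (Suc i)}) ` {..<Suc N} division_of {d 0 .. d (Suc N)}" "d 0 < d (Suc N)"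
    using Suc by simp_all
  have "{{d (Suc N)..d (Suc (Suc N))}} division_of {d (Suc N)..d (Suc (Suc N))}"
    using lt division_of_self[of "d (Suc N)" "d (Suc (Suc N))"] by simp
  from division_disjoint_union[OF IH(1) this]
  have "(\<lambda>i. {d i .. d (Suc i)}) ` {..<Suc N} \<union> {{d (Suc N)..d (Suc (Suc N))}} division_of
      {d 0 .. d (Suc N)} \<union> {d (Suc N)..d (Suc (Suc N))}"
    by simp
  moreover have "{d 0 .. d (Suc N)} \<union> {d (Suc N)..d (Suc (Suc N))} = {d 0..d (Suc (Suc N))}"
    using IH(2) lt by auto
  moreover have "{..<Suc (Suc N)} = insert (Suc N) {..<Suc N}" by auto
  ultimately show ?case using IH(2) lt by simp
qed

lemma dyadic_point_less: "i \<le> Suc p \<Longrightarrow> dyadic_point p i < dyadic_point p (Suc i)"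
  by (auto simp: dyadic_point_def field_simps)

lemma nadic_subdivision_dyadic_comb: "nadic_subdivision 2 (dyadic_comb p)"
  unfolding nadic_subdivision_def
proof (intro conjI ballI)
  have "dyadic_point p 0 = 0" "dyadic_point p (Suc (Suc p)) = 1"
    by (simp_all add: dyadic_point_def)
  then show "dyadic_comb p division_of {0..1}"
    using increasing_points_division[of "Suc p" "dyadic_point p"] dyadic_point_less
    by (simp add: dyadic_comb_def)
  fix K assume "K \<in> dyadic_comb p"
  then obtain i where i: "K = {dyadic_point p i .. dyadic_point p (Suc i)}" and "i \<in> {..<Suc (Suc p)}"
    unfolding dyadic_comb_def by (rule imageE)
  then have "i \<le> Suc p" by simp
  show "\<exists>k l. l + 1 \<le> 2 ^ k \<and> K = {real l / real 2 ^ k..real (l + 1) / real 2 ^ k}"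
  \<comment> \<open>The last interval has k = p + 1 and l = 2^k - 1; any earlier one has k = i + 1
    and l = 2^k - 2.\<close>
  proof (cases "i = Suc p")
    case True
    have "(1::nat) \<le> 2 ^ i" by simp
    then have "2 ^ i - 1 + 1 \<le> (2::nat) ^ i \<and>
        K = {real (2 ^ i - 1) / real 2 ^ i..real (2 ^ i - 1 + 1) / real 2 ^ i}"
      using True i by (simp add: dyadic_point_def of_nat_diff diff_divide_distrib)
    then show ?thesis by (intro exI)
  next
    case False
    have two: "(2::nat) \<le> 2 ^ Suc i" by simp
    then have "real (2 ^ Suc i - 2) = 2 ^ Suc i - 2" "real (2 ^ Suc i - 2 + 1) = 2 ^ Suc i - 1"
      by (simp_all add: of_nat_diff)
    moreover have "K = {(2 ^ Suc i - 2) / real 2 ^ Suc i..(2 ^ Suc i - 1) / real 2 ^ Suc i}"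
      using False i \<open>i \<le> Suc p\<close> by (simp add: dyadic_point_def diff_divide_distrib)
    moreover have "2 ^ Suc i - 2 + 1 \<le> (2::nat) ^ Suc i" using two by linarith
    ultimately have "2 ^ Suc i - 2 + 1 \<le> (2::nat) ^ Suc i \<and>
        K = {real (2 ^ Suc i - 2) / real 2 ^ Suc i..real (2 ^ Suc i - 2 + 1) / real 2 ^ Suc i}"
      by metis
    then show ?thesis by (intro exI)
  qed
qed

lemma image_affine_Icc:
  fixes a :: real
  assumes "a > 0" "x \<le> y"
  shows "(\<lambda>t. a * t + b) ` {x..y} = {a * x + b..a * y + b}"
  using assms by (simp add: image_affinity_atLeastAtMost)

lemma comb_lift_affine:
  assumes "i < Suc (Suc p)" and j: "j = (if Suc i = Suc (Suc p) then 0 else Suc i)"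
  shows "\<exists>a b :: real.
    (\<lambda>t. a * t + b) ` {dyadic_point p i .. dyadic_point p (Suc i)} =
      {dyadic_point p j .. dyadic_point p (Suc j)} \<and>
    (\<forall>t\<in>{dyadic_point p i .. dyadic_point p (Suc i)}. circ (comb_lift p t) = circ (a * t + b))"
proof -
  let ?x = "dyadic_point p i" and ?y = "dyadic_point p (Suc i)"
  have "?x \<le> ?y" using dyadic_point_less[of i p] assms by simp
  note image = image_affine_Icc[OF _ this]
  have x0: "0 \<le> ?x" and y1: "?y \<le> 1" by (simp_all add: dyadic_point_def)
  have unit: "comb_lift p t = comb_shift p t" if "t \<in> {?x..?y}" for t
    using that x0 y1 by (intro comb_lift_unit) auto
  consider "i < p" | "i = p" | "i = Suc p" using assms by linarith
  then show ?thesis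
  proof cases
    case 1
    have le: "1 / 2 ^ p \<le> 1 / (2::real) ^ Suc i"
      using 1 by (intro divide_left_mono power_increasing) auto
    have "comb_lift p t = 1 / 2 * t + 1 / 2" if "t \<in> {?x..?y}" for t
      using unit[OF that] comb_shift_left[of t p] that 1 le by (simp add: dyadic_point_def add_divide_distrib)
    moreover have "(\<lambda>t. 1 / 2 * t + 1 / 2) ` {?x..?y} = {dyadic_point p j .. dyadic_point p (Suc j)}"
      using 1 j by (subst image) (simp_all add: dyadic_point_def field_simps)
    ultimately show ?thesis by metis
  next
    case 2
    have "comb_lift p t = 1 * t + 1 / 2 ^ Suc p" if "t \<in> {?x..?y}" for t
      using unit[OF that] comb_shift_middle[of p t] that 2 by (simp add: dyadic_point_def)
    moreover have "(\<lambda>t. 1 * t + 1 / 2 ^ Suc p) ` {?x..?y} = {dyadic_point p j .. dyadic_point p (Suc j)}"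
      using 2 j by (subst image) (simp_all add: dyadic_point_def field_simps)
    ultimately show ?thesis by metis
  next
    case 3
    \<comment> \<open>The lift sends the last interval to [1,3/2]; lowering the constant by 1 gives
      the first interval without changing the point of the circle.\<close>
    have "circ (comb_lift p t) = circ (2 ^ p * t + (1 / 2 - 2 ^ p))" if "t \<in> {?x..?y}" for t
      using unit[OF that] comb_shift_right[of p t] that 3
      by (simp add: dyadic_point_def circ_eq_iff algebra_simps)
    moreover have "(\<lambda>t. 2 ^ p * t + (1 / 2 - 2 ^ p)) ` {?x..?y} =
        {dyadic_point p j .. dyadic_point p (Suc j)}"
      using 3 j by (subst image) (simp_all add: dyadic_point_def field_simps)
    ultimately show ?thesis by metis
  qed
qed

lemma affine_permutation_comb_lift: "affine_permutation (dyadic_comb p) (circle_map (comb_lift p))"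
proof -
  let ?N = "Suc (Suc p)"
  define e where "e i = {dyadic_point p i .. dyadic_point p (Suc i)}" for i
  define r where "r i = (if Suc i = ?N then 0 else Suc i)" for i
  have D: "dyadic_comb p = e ` {..<?N}" by (simp add: dyadic_comb_def e_def)
  have less: "i < j \<Longrightarrow> j \<le> ?N \<Longrightarrow> dyadic_point p i < dyadic_point p j" for i j
    by (induction j) (use dyadic_point_less[of _ p] in \<open>fastforce simp: less_Suc_eq intro: less_trans\<close>)+
  have "inj_on e {..<?N}"
  proof (rule linorder_inj_onI')
    fix i j assume ij: "i \<in> {..<?N}" "j \<in> {..<?N}" "i < j"
    then have "dyadic_point p i < dyadic_point p j" using less[of i j] by simp
    moreover have "dyadic_point p i < dyadic_point p (Suc i)" using dyadic_point_less[of i p] ij by simp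
    ultimately show "e i \<noteq> e j" by (auto simp: e_def Icc_eq_Icc)
  qed
  then have e: "bij_betw e {..<?N} (dyadic_comb p)" by (simp add: bij_betw_def D)
  have r: "bij_betw r {..<?N} {..<?N}"
    by (rule bij_betw_byWitness[where f' = "\<lambda>j. if j = 0 then Suc p else j - 1"])
      (auto simp: r_def)
  \<comment> \<open>The cyclic shift \<open>r\<close> of the indices, transported to the
    intervals.\<close>
  define \<sigma> where "\<sigma> = e \<circ> r \<circ> inv_into {..<?N} e"
  have "bij_betw \<sigma> (dyadic_comb p) (dyadic_comb p)"
    unfolding \<sigma>_def using bij_betw_trans[OF bij_betw_trans[OF bij_betw_inv_into[OF e] r] e]
    by (simp add: o_assoc)
  moreover have "\<exists>a b :: real. (\<lambda>t. a * t + b) ` K = \<sigma> K \<and>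
      (\<forall>t\<in>K. circle_map (comb_lift p) (circ t) = circ (a * t + b))" if K_in: "K \<in> dyadic_comb p" for K
  proof -
    obtain i where K: "K = e i" and "i \<in> {..<?N}" using K_in unfolding D by (rule imageE)
    then have i: "i < ?N" by simp
    then have "\<sigma> K = e (r i)"
      using bij_betw_inv_into_left[OF e, of i] by (simp add: \<sigma>_def K)
    then show ?thesis
      using comb_lift_affine[OF i r_def]
      by (simp add: K circle_map_circ[of "comb_lift p", OF comb_lift_degree_one] e_def[symmetric])
  qed
  ultimately show ?thesis unfolding affine_permutation_def by (intro exI[of _ \<sigma>] conjI ballI)
qed

lemma funpow_comb_lift_in_thompson_T: "circle_map (comb_lift p ^^ i) \<in> carrier (thompson_T 2)"
proof (rule circle_map_in_thompson_T)
  \<comment> \<open>Agreement on the circle suffices, as \<open>affine_permutation\<close> evaluates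
    its map only there.\<close>
  have "circle_map (comb_lift p ^^ i) (circ t) = (circle_map (comb_lift p) ^^ i) (circ t)" for t
    by (simp add: circle_map_circ[of "comb_lift p ^^ i", OF funpow_comb_lift_degree_one]
        funpow_lift[of "circle_map (comb_lift p)" "comb_lift p",
          OF circle_map_circ[of "comb_lift p", OF comb_lift_degree_one]])
  then have "affine_permutation (dyadic_comb p) (circle_map (comb_lift p ^^ i))"
    using affine_permutation_funpow[OF affine_permutation_comb_lift, of p i]
    by (simp add: affine_permutation_def)
  then show "nadic_affine 2 (circle_map (comb_lift p ^^ i))"
    by (rule affine_permutation_nadic[OF nadic_subdivision_dyadic_comb])
qed (simp_all add: funpow_comb_lift_degree_one strict_mono_funpow_comb_lift surj_funpow_comb_lift)

section \<open>The image of the torsion element under a homomorphism\<close>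

lemma carrier_thompson_T_D:
  assumes "f \<in> carrier (thompson_T n)"
  shows "f \<in> Bij S1" "orientation_preserving f" "nadic_affine n f"
  using assms by (simp_all add: thompson_T_def)

lemma mult_thompson_T:
  assumes "f \<in> carrier (thompson_T n)" "g \<in> carrier (thompson_T n)"
  shows "f \<otimes>\<^bsub>thompson_T n\<^esub> g = compose S1 f g"
  using assms by (simp add: thompson_T_def BijGroup_def)

theorem theorem3p4:
  fixes n :: nat
  assumes "n > 2"
  shows "\<not> (\<exists>h \<in> hom (thompson_T 2) (thompson_T n). inj_on h (carrier (thompson_T 2)))"
proof
  assume "\<exists>h \<in> hom (thompson_T 2) (thompson_T n). inj_on h (carrier (thompson_T 2))"
  then obtain h where hom: "h \<in> hom (thompson_T 2) (thompson_T n)"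
    and inj: "inj_on h (carrier (thompson_T 2))" by blast
  \<comment> \<open>The comb then has p + 2 = n - 1 intervals; the subtraction is not truncated
    because n > 2.\<close>
  define p where "p = n - 3"
  have n: "n - 1 = Suc (Suc p)" using assms by (simp add: p_def)
  define g where "g i = circle_map (comb_lift p ^^ i)" for i
  have g: "g i \<in> carrier (thompson_T 2)" for i
    by (simp add: g_def funpow_comb_lift_in_thompson_T)
  have hg: "h (g i) \<in> carrier (thompson_T n)" for i
    using hom g by (auto simp: hom_def)
  have g_add: "compose S1 (g i) (g j) = g (i + j)" for i j
    unfolding g_def funpow_add by (rule circle_map_comp) (rule funpow_comb_lift_degree_one)+
  have h_add: "h (g (i + j)) = compose S1 (h (g i)) (h (g j))" for i j
    using hom_mult[OF hom g[of i] g[of j]] by (simp add: mult_thompson_T g hg g_add)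
  have bij: "bij_betw (h (g i)) S1 S1" for i
    using carrier_thompson_T_D(1)[OF hg[of i]] by (simp add: Bij_def)
  \<comment> \<open>An idempotent bijection is the identity, so the image of \<open>g 0\<close>
    follows from multiplicativity alone.\<close>
  have h0: "h (g 0) z = z" if z: "z \<in> S1" for z
  proof -
    obtain w where w: "w \<in> S1" "z = h (g 0) w"
      using bij_betw_imp_surj_on[OF bij[of 0]] z by (metis imageE)
    have "h (g 0) w = h (g 0) (h (g 0) w)"
      using h_add[of 0 0] w(1) by (metis add_0 compose_eq)
    then show ?thesis using w by simp
  qed
  have h_funpow: "h (g i) z = (h (g 1) ^^ i) z" if z: "z \<in> S1" for i z
  proof (induction i)
    case (Suc i)
    have "h (g (Suc i)) z = h (g 1) (h (g i) z)"
      using h_add[of 1 i] z by (simp add: compose_def)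
    with Suc show ?case by simp
  qed (use h0[OF z] in simp)
  \<comment> \<open>Both iterates are integer translations, which induce the identity of the
    circle.\<close>
  have "comb_lift p ^^ (n - 1) = (\<lambda>x. x + of_int 1)"
    unfolding n using comb_lift_period[of p] by (intro ext) simp
  moreover have "comb_lift p ^^ 0 = (\<lambda>x. x + of_int 0)" by auto
  ultimately have "g (n - 1) = g 0"
    unfolding g_def by (simp only: circle_map_add_int)
  then have "(h (g 1) ^^ (n - 1)) z = z" if "z \<in> S1" for z
    using h_funpow[OF that, of "n - 1"] h0[OF that] by simp
  then have "h (g 1) z = z" if "z \<in> S1" for z
    using thompson_torsion_free_at_n_minus_1[of n "h (g 1)" z] that assms
      carrier_thompson_T_D[OF hg[of 1]] by simp
  then have "h (g 1) z = h (g 0) z" if "z \<in> S1" for z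
    using h0 that by simp
  \<comment> \<open>Elements of the group are extensional, so agreement on the circle is
    equality.\<close>
  moreover have "h (g i) \<in> extensional S1" for i
    using carrier_thompson_T_D(1)[OF hg[of i]] by (simp add: Bij_def)
  ultimately have "h (g 1) = h (g 0)"
    by (intro extensionalityI)
  then have "g 1 = g 0" using inj g by (auto dest: inj_onD)
  \<comment> \<open>The contradiction is read off at the base point, which \<open>g 1\<close> moves
    to \<open>circ (1 / 2)\<close>.\<close>
  then have "g 1 (circ 0) = g 0 (circ 0)" by simp
  then have "circ (comb_lift p 0) = circ 0"
    using circle_map_circ[of "comb_lift p ^^ 1", OF funpow_comb_lift_degree_one]
      circle_map_circ[of "comb_lift p ^^ 0", OF funpow_comb_lift_degree_one]
    by (simp add: g_def)
  then have "(1 / 2 :: real) \<in> \<int>"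
    by (simp add: circ_eq_iff comb_lift_unit comb_shift_0)
  then show False
    using Ints_nonzero_abs_ge1[of "1 / 2 :: real"] by simp
qed

end
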